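(* Let $P(u,v)=\bigl((0,0),(1,0),(1,1),(0,1),(u,v)\bigr)$ be a labeled pentagon in $\mathbb{R}^2$ with $uv(1-v)\ne0$ (so that Glick's operator $L_P$ is defined). Put $$\kappa(P)=\frac{(1-u)(u-v)(u+v-1)}{uv(1-v)}\qquad\text{and}\qquad\kappa_-=\frac{-11-5\sqrt5}2.$$ Then, with $P=P(u,v)$ and $G_P=L_P-3I$, $$\chi_{G_P}(t)=t^3-t^2+\kappa(P)t+\kappa(P).$$ If $P(u,v)$ is strictly convex and labeled in cyclic order, then $u<0$, $0<v<1$, and $\kappa(P)\le\kappa_-$. Equality occurs only at $(u,v)=\left(\frac{1-\sqrt5}4,\frac12\right)$.
   Context: Glick's operator: for a labeled $n$-gon $P=(p_1,\dots,p_n)$ (indices modulo $n$; here $n=5$) such that every consecutive triple of vertices is noncollinear, with nonzero homogeneous lifts $\widetilde p_i\in\mathbb{R}^3$ (for points $(x,y)\in\mathbb{R}^2$ one may take $(x,y,1)^\top$), $$L_P(w)=nw-\sum_{j=1}^n\frac{\det(\widetilde p_{j-1},w,\widetilde p_{j+1})}{\det(\widetilde p_{j-1},\widetilde p_j,\widetilde p_{j+1})}\,\widetilde p_j ,\qquad w\in\mathbb{R}^3,$$ independent of the lifts. $\chi_A(t)=\det(tI-A)$. *)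

theory Defs
  imports "HOL-Analysis.Analysis" "HOL-Computational_Algebra.Polynomial"
begin

text \<open>
  A labeled \<open>n\<close>-gon is a list of length \<open>n\<close>. Labels are counted from \<open>0\<close> and read modulo \<open>n\<close>;
  the predecessor of \<open>j\<close> is \<open>j + n - 1\<close>, which avoids truncated subtraction on \<open>nat\<close>.
\<close>

definition vertex :: "'a list \<Rightarrow> nat \<Rightarrow> 'a" where
  "vertex P j = P ! (j mod length P)"

definition pred_vertex :: "'a list \<Rightarrow> nat \<Rightarrow> 'a" where
  "pred_vertex P j = vertex P (j + length P - 1)"

definition succ_vertex :: "'a list \<Rightarrow> nat \<Rightarrow> 'a" where
  "succ_vertex P j = vertex P (j + 1)"

definition noncollinear_triples :: "(real \<times> real) list \<Rightarrow> bool" where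
  "noncollinear_triples P \<longleftrightarrow>
     (\<forall>j < length P. \<not> collinear {pred_vertex P j, vertex P j, succ_vertex P j})"

definition lift_point :: "real \<times> real \<Rightarrow> real ^ 3" where
  "lift_point p = vector [fst p, snd p, 1]"

text \<open>The determinant of the matrix with columns \<open>a\<close>, \<open>b\<close>, \<open>c\<close> (\<open>vector [a, b, c]\<close> has them as rows).\<close>

definition det_cols :: "real ^ 3 \<Rightarrow> real ^ 3 \<Rightarrow> real ^ 3 \<Rightarrow> real" where
  "det_cols a b c = det (transpose (vector [a, b, c] :: real ^ 3 ^ 3))"

text \<open>
  Glick's operator for a list \<open>Q\<close> of homogeneous lifts. It is meaningful only if no denominator
  vanishes, i.e. if all consecutive triples of points are noncollinear.
\<close>

definition glick_of_lifts :: "(real ^ 3) list \<Rightarrow> real ^ 3 \<Rightarrow> real ^ 3" where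
  "glick_of_lifts Q w = real (length Q) *\<^sub>R w -
     (\<Sum>j < length Q.
        (det_cols (pred_vertex Q j) w (succ_vertex Q j) /
         det_cols (pred_vertex Q j) (vertex Q j) (succ_vertex Q j)) *\<^sub>R vertex Q j)"

definition glick :: "(real \<times> real) list \<Rightarrow> real ^ 3 \<Rightarrow> real ^ 3" where
  "glick P = glick_of_lifts (map lift_point P)"

lemma det_cols_scale:
  "det_cols (r *\<^sub>R a) (s *\<^sub>R b) (t *\<^sub>R c) = r * s * t * det_cols a b c"
  by (simp add: det_cols_def det_3 transpose_def vector_3 algebra_simps)

lemma det_cols_add: "det_cols a (w + w') c = det_cols a w c + det_cols a w' c"
  by (simp add: det_cols_def det_3 transpose_def vector_3 algebra_simps)

lemma linear_glick_of_lifts: "linear (glick_of_lifts Q)"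
proof (rule linearI)
  fix w w' :: "real ^ 3" and r :: real
  show "glick_of_lifts Q (w + w') = glick_of_lifts Q w + glick_of_lifts Q w'"
    by (simp add: glick_of_lifts_def det_cols_add add_divide_distrib scaleR_add_left
        scaleR_add_right sum.distrib)
  have *: "det_cols a (r *\<^sub>R w) c = r * det_cols a w c" for a c
    using det_cols_scale[of 1 a r w 1 c] by simp
  show "glick_of_lifts Q (r *\<^sub>R w) = r *\<^sub>R glick_of_lifts Q w"
    by (simp add: glick_of_lifts_def * scaleR_diff_right scaleR_sum_right mult.commute)
qed

lemma glick_of_lifts_independent:
  assumes "length Q' = length Q"
    and "\<forall>j < length Q. c j \<noteq> 0 \<and> Q' ! j = c j *\<^sub>R Q ! j"
  shows "glick_of_lifts Q' = glick_of_lifts Q"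
proof
  fix w
  have v: "vertex Q' j = c (j mod length Q) *\<^sub>R vertex Q j" "c (j mod length Q) \<noteq> 0"
    if "Q \<noteq> []" for j
    using assms that by (simp_all add: vertex_def)
  have *: "(det_cols (pred_vertex Q' j) w (succ_vertex Q' j) /
         det_cols (pred_vertex Q' j) (vertex Q' j) (succ_vertex Q' j)) *\<^sub>R vertex Q' j =
       (det_cols (pred_vertex Q j) w (succ_vertex Q j) /
         det_cols (pred_vertex Q j) (vertex Q j) (succ_vertex Q j)) *\<^sub>R vertex Q j"
    if "j < length Q" for j
  proof -
    have ne: "Q \<noteq> []" using that by auto
    have s: "det_cols (r *\<^sub>R a) w (t *\<^sub>R b) = r * t * det_cols a w b" for r t a b
      using det_cols_scale[of r a 1 w t b] by simp
    show ?thesis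
      using v(2)[OF ne, of j] v(2)[OF ne, of "j + length Q - 1"] v(2)[OF ne, of "j + 1"]
      by (simp add: pred_vertex_def succ_vertex_def v(1)[OF ne] assms(1) s det_cols_scale
          del: One_nat_def)
  qed
  show "glick_of_lifts Q' w = glick_of_lifts Q w"
    unfolding glick_of_lifts_def assms(1)
    by (intro arg_cong2[where f = minus] refl sum.cong *) simp
qed

text \<open>The characteristic polynomial \<open>det (t I - A)\<close>, computed over \<open>\<real>[t]\<close>.\<close>

definition charpoly :: "real ^ 'n ^ 'n \<Rightarrow> real poly" where
  "charpoly A = det (mat [:0, 1:] - (\<chi> i j. [:A $ i $ j:]))"

text \<open>
  A labeled polygon is strictly convex and labeled in cyclic order if its vertices are distinct
  extreme points of their convex hull and consecutive vertices span edges of that hull.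
\<close>

definition strictly_convex_cyclic :: "(real \<times> real) list \<Rightarrow> bool" where
  "strictly_convex_cyclic P \<longleftrightarrow>
     3 \<le> length P \<and> distinct P \<and>
     (\<forall>p \<in> set P. p extreme_point_of (convex hull set P)) \<and>
     (\<forall>j < length P. closed_segment (vertex P j) (succ_vertex P j) edge_of (convex hull set P))"

definition pentagon :: "real \<Rightarrow> real \<Rightarrow> (real \<times> real) list" where
  "pentagon u v = [(0, 0), (1, 0), (1, 1), (0, 1), (u, v)]"

definition kappa :: "real \<Rightarrow> real \<Rightarrow> real" where
  "kappa u v = (1 - u) * (u - v) * (u + v - 1) / (u * v * (1 - v))"

definition kappa_minus :: real where
  "kappa_minus = (- 11 - 5 * sqrt 5) / 2"

definition G_op :: "(real \<times> real) list \<Rightarrow> real ^ 3 \<Rightarrow> real ^ 3" where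
  "G_op P w = glick P w - 3 *\<^sub>R w"

end

theory Submission
  imports Defs
begin

text \<open>
  A segment spanned by two vertices is an edge of the hull of a finite planar set exactly when
  the set lies on one side of the line through them and meets it only at the two vertices, so
  strict convexity becomes a sign condition on the signed areas \<open>orient\<close>. For \<open>P(u,v)\<close> these
  conditions amount to \<open>u < 0 < v < 1\<close>. With \<open>s = - u\<close> and \<open>m = v (1 - v) \<le> 1/4\<close> one has
  \<open>- \<kappa> = (1 + s) (s\<^sup>2 + s + m) / (s m) \<ge> (1 + s) (2 s + 1)\<^sup>2 / s\<close>, with equality iff \<open>v = 1/2\<close>.
  The cubic \<open>(1 + s) (2 s + 1)\<^sup>2 + \<kappa>\<^sub>- s\<close> has the double root \<open>(\<surd>5 - 1) / 4\<close> and a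
  negative third root.
\<close>

section \<open>Signed areas and convex polygons\<close>

definition orient :: "real \<times> real \<Rightarrow> real \<times> real \<Rightarrow> real \<times> real \<Rightarrow> real" where
  "orient p q r = (fst q - fst p) * (snd r - snd p) - (snd q - snd p) * (fst r - fst p)"

lemma orient_same [simp]: "orient p p r = 0" "orient p q p = 0" "orient p q q = 0"
  by (simp_all add: orient_def)

lemma orient_inner: "orient p q r = (snd p - snd q, fst q - fst p) \<bullet> (r - p)"
  by (simp add: orient_def inner_prod_def algebra_simps)

lemma collinear_imp_orient_eq_0:
  assumes "collinear {p, q, r}"
  shows "orient p q r = 0"
proof -
  obtain w where w: "\<forall>x\<in>{p, q, r}. \<forall>y\<in>{p, q, r}. \<exists>c. x - y = c *\<^sub>R w"
    using assms unfolding collinear_def by blast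
  obtain c d where "q - p = c *\<^sub>R w" "r - p = d *\<^sub>R w"
    using w by blast
  then have "fst q - fst p = c * fst w" "snd q - snd p = c * snd w"
    "fst r - fst p = d * fst w" "snd r - snd p = d * snd w"
    by (simp_all add: prod_eq_iff)
  then show ?thesis
    by (simp add: orient_def)
qed

text \<open>Faces of a polytope are exposed, so some linear functional attains its maximum over the
  hull exactly on the segment. Being constant on the segment, it equals \<open>orient p q\<close> up
  to a factor \<open>k\<close> and a constant. The sign of \<open>k\<close> depends on the
  orientation of the polygon, hence the product in the conclusion.\<close>

lemma face_of_imp_orient_same_side:
  assumes "finite S" and face: "closed_segment p q face_of convex hull S"
    and "r \<in> S" "s \<in> S"
  shows "0 \<le> orient p q r * orient p q s"
proof (cases "p = q")
  case False
  have "closed_segment p q exposed_face_of convex hull S"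
    using face \<open>finite S\<close> exposed_face_of_polyhedron polytope_convex_hull
      polytope_imp_polyhedron by blast
  then obtain a b where le: "convex hull S \<subseteq> {x. a \<bullet> x \<le> b}"
    and eq: "closed_segment p q = convex hull S \<inter> {x. a \<bullet> x = b}"
    unfolding exposed_face_of_def by blast
  have pq: "a \<bullet> p = b" "a \<bullet> q = b"
    using eq by auto
  define n where "n = (snd p - snd q, fst q - fst p)"
  define k where "k = (a \<bullet> n) / (n \<bullet> n)"
  have "n \<bullet> n \<noteq> 0"
    using False by (auto simp: n_def prod_eq_iff)
  \<comment> \<open>In the plane the vectors orthogonal to \<open>q - p\<close> form a line, spanned
    by the rotated difference \<open>n\<close>; so \<open>a\<close> equals its projection onto
    \<open>n\<close>.\<close>
  moreover have "(n \<bullet> n) *\<^sub>R a = (a \<bullet> n) *\<^sub>R n"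
  proof -
    have "fst a * (fst q - fst p) + snd a * (snd q - snd p) = 0"
      using pq by (simp add: inner_prod_def algebra_simps)
    then show ?thesis
      unfolding prod_eq_iff n_def by (simp add: inner_prod_def) algebra
  qed
  ultimately have a: "a = k *\<^sub>R n"
    unfolding k_def by (metis divideR_right scaleR_scaleR divide_inverse_commute)
  have side: "a \<bullet> x - b = k * orient p q x" for x
    using pq by (simp add: orient_inner a flip: n_def) (simp add: inner_diff_right algebra_simps)
  have in_hull: "r \<in> convex hull S" "s \<in> convex hull S"
    using assms by (auto intro: hull_inc)
  then have sgn: "k * orient p q r \<le> 0" "k * orient p q s \<le> 0"
    using le side[of r] side[of s] by auto
  show ?thesis
  proof (cases "k = 0")
    \<comment> \<open>Exposed faces allow the zero functional. The face is then the whole hull,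
      which is flat, and every signed area vanishes.\<close>
    case True
    then have "a = 0" "b = 0"
      using a pq by auto
    then have "r \<in> closed_segment p q"
      using eq in_hull by auto
    then obtain t where "r - p = t *\<^sub>R (q - p)"
      by (auto simp: in_segment algebra_simps)
    then have "orient p q r = 0"
      by (simp add: orient_def prod_eq_iff)
    then show ?thesis by simp
  next
    case False
    have "0 \<le> (k * orient p q r) * (k * orient p q s)"
      using sgn by (rule mult_nonpos_nonpos)
    also have "\<dots> = k\<^sup>2 * (orient p q r * orient p q s)"
      by (simp add: power2_eq_square)
    finally show ?thesis
      using False by (simp add: zero_le_mult_iff)
  qed
qed simp

text \<open>The line \<open>H\<close> through \<open>p\<close> and \<open>q\<close> supports the
  hull, so it cuts out a face. Strict positivity keeps all other points of \<open>S\<close> off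
  \<open>H\<close>, which makes this face the segment itself.\<close>

lemma orient_pos_imp_edge_of:
  assumes "finite S" "p \<in> S" "q \<in> S" "p \<noteq> q"
    and pos: "\<And>r. r \<in> S - {p, q} \<Longrightarrow> 0 < orient p q r"
  shows "closed_segment p q edge_of convex hull S"
proof -
  define n where "n = (snd p - snd q, fst q - fst p)"
  define H where "H = {x. n \<bullet> x = n \<bullet> p}"
  have eq: "orient p q x = n \<bullet> x - n \<bullet> p" for x
    by (simp add: orient_inner n_def inner_diff_right)
  have ge: "n \<bullet> p \<le> n \<bullet> x" if "x \<in> S" for x
    using pos[of x] that orient_same(3)[of p q] unfolding eq by (cases "x \<in> {p, q}") auto
  have "convex hull S \<subseteq> {x. n \<bullet> p \<le> n \<bullet> x}"
    by (rule hull_minimal) (use ge in \<open>auto simp: convex_halfspace_ge\<close>)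
  then have face: "(convex hull S \<inter> H) face_of convex hull S"
    unfolding H_def by (intro face_of_Int_supporting_hyperplane_ge) auto
  \<comment> \<open>A face of the hull of \<open>S\<close> is the hull of some points of
    \<open>S\<close>, so it suffices to decide which of these lie on \<open>H\<close>.\<close>
  obtain S' where S': "S' \<subseteq> S" "convex hull S \<inter> H = convex hull S'"
    using face_of_convex_hull_subset[OF finite_imp_compact[OF \<open>finite S\<close>] face] by blast
  have "S' \<subseteq> {p, q}"
  proof
    fix x assume x: "x \<in> S'"
    then have "x \<in> H"
      using S'(2) hull_inc[OF x, of convex] by auto
    then have "orient p q x = 0"
      by (simp add: H_def eq)
    then show "x \<in> {p, q}"
      using pos[of x] x S' by fastforce
  qed
  then have "convex hull S' \<subseteq> closed_segment p q"
    by (simp add: segment_convex_hull hull_mono)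
  moreover have "closed_segment p q \<subseteq> convex hull S'"
  proof -
    have "p \<in> H" "q \<in> H"
      using eq[of q] by (simp_all add: H_def)
    then have "{p, q} \<subseteq> convex hull S'"
      unfolding S'(2)[symmetric] using assms(2,3) by (simp add: hull_inc)
    then show ?thesis
      by (simp add: closed_segment_subset)
  qed
  ultimately have "closed_segment p q face_of convex hull S"
    using face S' by auto
  moreover have "aff_dim (closed_segment p q) = 1"
    using \<open>p \<noteq> q\<close> by (simp add: segment_convex_hull aff_dim_convex_hull)
  ultimately show ?thesis
    by (simp add: edge_of_def)
qed

text \<open>Extremality of the vertices comes for free: an endpoint is extreme in its edge, and a
  face of a face is a face.\<close>

lemma strictly_convex_cyclicI:
  assumes "3 \<le> length P" "distinct P"
    and pos: "\<And>j r. j < length P \<Longrightarrow> r \<in> set P - {vertex P j, succ_vertex P j} \<Longrightarrow>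
      0 < orient (vertex P j) (succ_vertex P j) r"
  shows "strictly_convex_cyclic P"
proof -
  have edge: "closed_segment (vertex P j) (succ_vertex P j) edge_of convex hull set P"
    if j: "j < length P" for j
  proof (rule orient_pos_imp_edge_of)
    have "Suc j mod length P < length P"
      using j by (intro mod_less_divisor) auto
    then show "vertex P j \<in> set P" "succ_vertex P j \<in> set P"
      using j by (simp_all add: vertex_def succ_vertex_def)
    \<comment> \<open>Only the last index wraps around, to 0, and it differs from 0 because there
      are at least three vertices.\<close>
    have "j \<noteq> Suc j mod length P"
      using j assms(1) by (cases "Suc j = length P") auto
    then show "vertex P j \<noteq> succ_vertex P j"
      using \<open>Suc j mod length P < length P\<close> j assms(2)
      by (simp add: vertex_def succ_vertex_def nth_eq_iff_index_eq)
  qed (use pos j in auto)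
  have "x extreme_point_of (convex hull set P)" if x: "x \<in> set P" for x
  proof -
    obtain j where j: "j < length P" "x = vertex P j"
      using x by (metis in_set_conv_nth mod_less vertex_def)
    show ?thesis
      using edge[OF j(1)] j(2) extreme_point_of_face extreme_point_of_segment
      unfolding edge_of_def by blast
  qed
  then show ?thesis
    using assms edge by (simp add: strictly_convex_cyclic_def)
qed

section \<open>The pentagon\<close>

lemma all_less_5: "(\<forall>j<5. P j) \<longleftrightarrow> P 0 \<and> P 1 \<and> P 2 \<and> P 3 \<and> P (4 :: nat)"
  by (auto simp: numeral_eq_Suc less_Suc_eq)

lemma length_pentagon [simp]: "length (pentagon u v) = 5"
  by (simp add: pentagon_def)

lemma pentagon_vertices:
  "vertex (pentagon u v) 0 = (0, 0)" "vertex (pentagon u v) 1 = (1, 0)"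
  "vertex (pentagon u v) 2 = (1, 1)" "vertex (pentagon u v) 3 = (0, 1)"
  "vertex (pentagon u v) 4 = (u, v)"
  "pred_vertex (pentagon u v) 0 = (u, v)" "pred_vertex (pentagon u v) 1 = (0, 0)"
  "pred_vertex (pentagon u v) 2 = (1, 0)" "pred_vertex (pentagon u v) 3 = (1, 1)"
  "pred_vertex (pentagon u v) 4 = (0, 1)"
  "succ_vertex (pentagon u v) 0 = (1, 0)" "succ_vertex (pentagon u v) 1 = (1, 1)"
  "succ_vertex (pentagon u v) 2 = (0, 1)" "succ_vertex (pentagon u v) 3 = (u, v)"
  "succ_vertex (pentagon u v) 4 = (0, 0)"
  by (simp_all add: pentagon_def vertex_def pred_vertex_def succ_vertex_def)

text \<open>The signed areas of the consecutive triples are v, 1, 1, 1 - v and -u, whose product is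
  -u v (1 - v).\<close>

lemma noncollinear_triples_pentagon:
  assumes "u * v * (1 - v) \<noteq> 0"
  shows "noncollinear_triples (pentagon u v)"
proof -
  have "\<forall>j<5. orient (pred_vertex (pentagon u v) j) (vertex (pentagon u v) j)
      (succ_vertex (pentagon u v) j) \<noteq> 0"
    unfolding all_less_5 pentagon_vertices using assms by (auto simp: orient_def algebra_simps)
  then show ?thesis
    unfolding noncollinear_triples_def using collinear_imp_orient_eq_0 by fastforce
qed

text \<open>Three edges suffice for the forward direction. The horizontal ones, starting at vertices
  0 and 2, confine v to [0, 1]; the edge from (u, v) to the origin has (1, 0) and (0, 1) on the same
  side, so u v is at most 0. The hypothesis makes the inequalities strict.\<close>

lemma strictly_convex_cyclic_pentagon_iff:
  assumes "u * v * (1 - v) \<noteq> 0"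
  shows "strictly_convex_cyclic (pentagon u v) \<longleftrightarrow> u < 0 \<and> 0 < v \<and> v < 1"
proof
  assume sc: "strictly_convex_cyclic (pentagon u v)"
  have side: "0 \<le> orient (vertex (pentagon u v) j) (succ_vertex (pentagon u v) j) r *
      orient (vertex (pentagon u v) j) (succ_vertex (pentagon u v) j) s"
    if "j < 5" "r \<in> set (pentagon u v)" "s \<in> set (pentagon u v)" for j r s
    using sc that unfolding strictly_convex_cyclic_def edge_of_def
    by (intro face_of_imp_orient_same_side[of "set (pentagon u v)"]) auto
  have "0 \<le> v"
    using side[of 0 "(0, 1)" "(u, v)"] pentagon_vertices[of u v]
    by (simp add: orient_def pentagon_def)
  moreover have "v \<le> 1"
    using side[of 2 "(0, 0)" "(u, v)"] pentagon_vertices[of u v]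
    by (simp add: orient_def pentagon_def)
  moreover have "u * v \<le> 0"
    using side[of 4 "(1, 0)" "(0, 1)"] pentagon_vertices[of u v]
    by (simp add: orient_def pentagon_def algebra_simps)
  ultimately show "u < 0 \<and> 0 < v \<and> v < 1"
    using assms by (auto simp: mult_le_0_iff)
next
  assume uv: "u < 0 \<and> 0 < v \<and> v < 1"
  show "strictly_convex_cyclic (pentagon u v)"
  proof (rule strictly_convex_cyclicI)
    have "\<forall>j<5. \<forall>r \<in> set (pentagon u v) -
        {vertex (pentagon u v) j, succ_vertex (pentagon u v) j}.
      0 < orient (vertex (pentagon u v) j) (succ_vertex (pentagon u v) j) r"
      unfolding all_less_5 pentagon_vertices using uv
      by (auto simp: orient_def pentagon_def algebra_simps)
    then show "0 < orient (vertex (pentagon u v) j) (succ_vertex (pentagon u v) j) r"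
      if "j < length (pentagon u v)"
        "r \<in> set (pentagon u v) - {vertex (pentagon u v) j, succ_vertex (pentagon u v) j}" for j r
      using that by auto
  qed (use uv in \<open>auto simp: pentagon_def\<close>)
qed

section \<open>The characteristic polynomial\<close>

lemma charpoly_3:
  fixes A :: "real ^ 3 ^ 3"
  shows "charpoly A = [: - det A,
    A$1$1 * A$2$2 - A$1$2 * A$2$1 + A$1$1 * A$3$3 - A$1$3 * A$3$1 + A$2$2 * A$3$3 - A$2$3 * A$3$2,
    - (A$1$1 + A$2$2 + A$3$3), 1:]"
  by (simp add: charpoly_def det_3 mat_def algebra_simps)

lemma det_cols_expand:
  "det_cols a b c = a$1 * (b$2 * c$3 - b$3 * c$2) - a$2 * (b$1 * c$3 - b$3 * c$1)
    + a$3 * (b$1 * c$2 - b$2 * c$1)"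
  by (simp add: det_cols_def det_3 transpose_def vector_3 algebra_simps)

text \<open>The standard-basis matrix of 2 w minus the five rank-one terms of Glick's operator,
  where 2 is 5 - 3. Its first row is constant since the factor u of the last vertex cancels the
  denominator -u.\<close>

definition pentagon_matrix :: "real \<Rightarrow> real \<Rightarrow> real ^ 3 ^ 3" where
  "pentagon_matrix u v = vector
     [vector [-1, 0, 1],
      vector [- v / u, 1 - (1 - u) / (1 - v), 1 - (u - v) / (1 - v)],
      vector [- 1 / u, (1 - u) / v - (1 - u) / (1 - v), 2 - (u - v) / (1 - v)]]"

lemma sum_less_5: "(\<Sum>j<5. f j) = f 0 + f 1 + f 2 + f 3 + f (4 :: nat)"
  by (simp add: numeral_eq_Suc add.assoc)

lemma lift_point_vertices:
  assumes "P \<noteq> []"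
  shows "vertex (map lift_point P) j = lift_point (vertex P j)"
    "pred_vertex (map lift_point P) j = lift_point (pred_vertex P j)"
    "succ_vertex (map lift_point P) j = lift_point (succ_vertex P j)"
  using assms by (simp_all add: vertex_def pred_vertex_def succ_vertex_def)

lemma G_op_pentagon:
  assumes "u * v * (1 - v) \<noteq> 0"
  shows "G_op (pentagon u v) w = pentagon_matrix u v *v w"
proof -
  have ne: "pentagon u v \<noteq> []"
    by (simp add: pentagon_def)
  have nz: "u \<noteq> 0" "v \<noteq> 0" "1 - v \<noteq> 0"
    using assms by auto
  have den: "det_cols (lift_point (u, v)) (lift_point (0, 0)) (lift_point (1, 0)) = v"
    "det_cols (lift_point (0, 0)) (lift_point (1, 0)) (lift_point (1, 1)) = 1"
    "det_cols (lift_point (1, 0)) (lift_point (1, 1)) (lift_point (0, 1)) = 1"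
    "det_cols (lift_point (1, 1)) (lift_point (0, 1)) (lift_point (u, v)) = 1 - v"
    "det_cols (lift_point (0, 1)) (lift_point (u, v)) (lift_point (0, 0)) = - u"
    by (simp_all add: det_cols_expand lift_point_def)
  have num: "det_cols (lift_point (u, v)) w (lift_point (1, 0)) = (u - 1) * w$2 - v * w$1 + v * w$3"
    "det_cols (lift_point (0, 0)) w (lift_point (1, 1)) = w$1 - w$2"
    "det_cols (lift_point (1, 0)) w (lift_point (0, 1)) = w$1 + w$2 - w$3"
    "det_cols (lift_point (1, 1)) w (lift_point (u, v)) =
      (v - 1) * w$1 + (1 - u) * w$2 + (u - v) * w$3"
    "det_cols (lift_point (0, 1)) w (lift_point (0, 0)) = - w$1"
    by (simp_all add: det_cols_expand lift_point_def algebra_simps)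
  show ?thesis
    unfolding G_op_def glick_def glick_of_lifts_def length_map length_pentagon sum_less_5
      lift_point_vertices[OF ne] pentagon_vertices den num
    by (simp add: vec_eq_iff forall_3 matrix_vector_mult_def sum_3 pentagon_matrix_def
        lift_point_def)
      (use nz in \<open>simp add: divide_simps; simp add: algebra_simps\<close>)
qed

text \<open>The trace is 15 - 5 - 9 = 1, as each rank-one term is a projection of trace 1. The other
  coefficients are checked by clearing denominators.\<close>

lemma charpoly_G_op_pentagon:
  assumes "u * v * (1 - v) \<noteq> 0"
  shows "charpoly (matrix (G_op (pentagon u v))) = [:kappa u v, kappa u v, -1, 1:]"
proof -
  have nz: "u \<noteq> 0" "v \<noteq> 0" "1 - v \<noteq> 0"
    using assms by auto
  have "G_op (pentagon u v) = (*v) (pentagon_matrix u v)"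
    using G_op_pentagon[OF assms] by auto
  then have "matrix (G_op (pentagon u v)) = pentagon_matrix u v"
    by simp
  then show ?thesis
    by (simp add: charpoly_3 det_3 pentagon_matrix_def kappa_def)
      (use nz in \<open>simp add: divide_simps; simp add: algebra_simps\<close>)
qed

section \<open>The extremal value\<close>

text \<open>Multiplied by the positive number \<open>- u * m\<close>, the gap
  \<open>kappa_minus - kappa u v\<close> splits into nonnegative terms \<open>A\<close> and
  \<open>B\<close>; \<open>A\<close> vanishes only at the extremal v and \<open>B\<close> only at
  the extremal u.\<close>

lemma kappa_le_kappa_minus:
  assumes "u < 0" "0 < v" "v < 1"
  shows "kappa u v \<le> kappa_minus"
    and "kappa u v = kappa_minus \<longleftrightarrow> u = (1 - sqrt 5) / 4 \<and> v = 1 / 2"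
proof -
  define m where "m = v * (1 - v)"
  have m: "m > 0" "1 / 4 - m = (v - 1 / 2)\<^sup>2"
    using assms by (simp_all add: m_def power2_eq_square algebra_simps)
  have um: "- u * m > 0"
    using assms m by (simp add: mult_neg_pos)
  \<comment> \<open>The split comes from u^2 - u + m = (u^2 - u)(1 - 4m) + m (1 - 2u)^2:
    \<open>A\<close> is the cost of m being below 1/4, and \<open>B\<close> is what remains.\<close>
  define A where "A = (1 - u) * (u\<^sup>2 - u) * (1 - 4 * m)"
  define B where "B = 4 * m * ((u - (1 - sqrt 5) / 4)\<^sup>2 * ((3 + sqrt 5) / 2 - u))"
  \<comment> \<open>The right side has leading coefficients -4 and 8, so its roots sum to 2; the
    double root (1 - sqrt 5)/4 leaves (3 + sqrt 5)/2 as the third.\<close>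
  have cubic: "4 * ((u - (1 - sqrt 5) / 4)\<^sup>2 * ((3 + sqrt 5) / 2 - u)) =
      (1 - u) * (1 - 2 * u)\<^sup>2 - kappa_minus * u"
  proof -
    have "sqrt 5 * sqrt 5 = 5" by simp
    then show ?thesis
      unfolding kappa_minus_def power2_eq_square by (simp add: field_simps)
  qed
  have "kappa u v * (u * m) = (1 - u) * (u\<^sup>2 - u + m)"
    using assms unfolding kappa_def m_def
    by (simp add: divide_simps) (simp add: power2_eq_square algebra_simps)
  moreover have "A + B = (1 - u) * (u\<^sup>2 - u + m) - kappa_minus * u * m"
  proof -
    have "B = m * ((1 - u) * (1 - 2 * u)\<^sup>2 - kappa_minus * u)"
      unfolding B_def cubic[symmetric] by simp
    then show ?thesis
      unfolding A_def by (simp add: power2_eq_square algebra_simps)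
  qed
  ultimately have key: "(kappa_minus - kappa u v) * (- u * m) = A + B"
    by (simp add: algebra_simps)
  have u: "0 < (1 - u) * (u\<^sup>2 - u)"
    using assms by (intro mult_pos_pos) (auto simp: power2_eq_square intro: add_pos_pos mult_neg_neg)
  have "A = (1 - u) * (u\<^sup>2 - u) * (4 * (v - 1 / 2)\<^sup>2)"
    unfolding A_def m(2)[symmetric] by simp
  then have A: "A \<ge> 0" "A = 0 \<longleftrightarrow> v = 1 / 2"
    using u by (auto intro!: mult_nonneg_nonneg)
  have "0 < (3 + sqrt 5) / 2 - u"
    using add_pos_nonneg[of 3 "sqrt 5"] assms(1) by simp
  then have B: "B \<ge> 0" "B = 0 \<longleftrightarrow> u = (1 - sqrt 5) / 4"
    using m(1) by (simp_all add: B_def)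
  show "kappa u v \<le> kappa_minus"
    using A(1) B(1) um zero_le_mult_iff[of "kappa_minus - kappa u v" "- u * m"]
    unfolding key by linarith
  have "kappa u v = kappa_minus \<longleftrightarrow> (kappa_minus - kappa u v) * (- u * m) = 0"
    using um unfolding mult_eq_0_iff[of "kappa_minus - kappa u v"] by linarith
  also have "\<dots> \<longleftrightarrow> A = 0 \<and> B = 0"
    unfolding key using A(1) B(1) by (rule add_nonneg_eq_0_iff)
  finally show "kappa u v = kappa_minus \<longleftrightarrow> u = (1 - sqrt 5) / 4 \<and> v = 1 / 2"
    using A(2) B(2) by blast
qed

theorem lemma5p15:
  fixes u v :: real
  assumes "u * v * (1 - v) \<noteq> 0"
  shows "noncollinear_triples (pentagon u v) \<and>
    charpoly (matrix (G_op (pentagon u v))) = [:kappa u v, kappa u v, -1, 1:] \<and>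
    (strictly_convex_cyclic (pentagon u v) \<longrightarrow>
       u < 0 \<and> 0 < v \<and> v < 1 \<and> kappa u v \<le> kappa_minus) \<and>
    (strictly_convex_cyclic (pentagon u v) \<and> kappa u v = kappa_minus \<longleftrightarrow>
       (u, v) = ((1 - sqrt 5) / 4, 1 / 2))"
proof -
  \<comment> \<open>The converse of the equality claim needs the extremal point to lie in the
    strictly convex range, which follows from sqrt 5 > 1.\<close>
  have "u < 0 \<and> 0 < v \<and> v < 1" if "(u, v) = ((1 - sqrt 5) / 4, 1 / 2)"
    using that real_sqrt_gt_1_iff[of 5] by (simp del: real_sqrt_gt_1_iff)
  then show ?thesis
    using noncollinear_triples_pentagon[OF assms] charpoly_G_op_pentagon[OF assms]
      strictly_convex_cyclic_pentagon_iff[OF assms] kappa_le_kappa_minus[of u v] by auto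
qed

end
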